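(* Let $p$ be a prime number and let $F\subset\mathbb{Z}_p$ be a closed set. Then $$d^{*}(F\cap\mathbb{Z})\le \mu_p(F).$$ Moreover, if $\mu_p(\partial F)=0$, then $d^{*}(F\cap\mathbb{Z})=\mu_p(F)$.
   Context: $\mathbb{Z}_p$ is the ring of $p$-adic integers with the metric $|x-y|_p$, and $\mathbb{Z}\subset\mathbb{Z}_p$. $\mu_p$ is the Haar probability measure on the Borel sets of $\mathbb{Z}_p$, so that $\mu_p(B_{p^{-n}}(x))=p^{-n}$ for $n\ge 0$, where $B_r(x)=\{y\in\mathbb{Z}_p: |x-y|_p\le r\}$. $\partial F$ is the topological boundary of $F$ in $\mathbb{Z}_p$. An interval of integers is a set $I=(M,N]=\{M+1,\dots,N\}\subset\mathbb{Z}$, with length $|I|=N-M$; $|A|$ denotes the number of elements of a finite set $A$. The upper Banach density of $E\subset\mathbb{Z}$ is $d^{*}(E)=\limsup_{|I|\to\infty}\frac{|E\cap I|}{|I|}$, where $I$ runs over all intervals of integers, i.e. $\lim_{L\to\infty}\sup\{|E\cap I|/|I| : |I|\ge L\}$. *)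

theory Defs
  imports "HOL-Probability.Probability" "HOL-Algebra.Ring"
begin

(* The p-adic integers as the inverse limit of the rings Z/p^n: the n-th entry x n is the
   representative in {0..<p^n} of the residue class of x modulo p^n (coherence forces x n into
   this range).  The prime p is an ordinary variable, so the type of the elements does not
   determine the ring; everything is relative to its carrier. *)
definition padic_int :: "nat \<Rightarrow> (nat \<Rightarrow> int) ring" where
  "padic_int p =
    \<lparr>carrier = {x. \<forall>n. x (Suc n) mod int p ^ n = x n},
     mult = (\<lambda>x y n. (x n * y n) mod int p ^ n),
     one = (\<lambda>n. 1 mod int p ^ n),
     zero = (\<lambda>n. 0),
     add = (\<lambda>x y n. (x n + y n) mod int p ^ n)\<rparr>"

definition padic_of_int :: "nat \<Rightarrow> int \<Rightarrow> (nat \<Rightarrow> int)" where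
  "padic_of_int p k = (\<lambda>n. k mod int p ^ n)"

(* x n = 0 means that p^n divides x, so the greatest such n is the p-adic valuation of x. *)
definition padic_norm :: "nat \<Rightarrow> (nat \<Rightarrow> int) \<Rightarrow> real" where
  "padic_norm p x =
    (if x = \<zero>\<^bsub>padic_int p\<^esub> then 0 else 1 / real p ^ (GREATEST n. x n = 0))"

(* The locale Metric_space demands nonnegativity and symmetry on the whole type, hence the default
   value 0 outside the carrier. *)
definition padic_dist :: "nat \<Rightarrow> (nat \<Rightarrow> int) \<Rightarrow> (nat \<Rightarrow> int) \<Rightarrow> real" where
  "padic_dist p x y =
    (if x \<in> carrier (padic_int p) \<and> y \<in> carrier (padic_int p)
     then padic_norm p (x \<ominus>\<^bsub>padic_int p\<^esub> y) else 0)"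

definition padic_topology :: "nat \<Rightarrow> (nat \<Rightarrow> int) topology" where
  "padic_topology p = Metric_space.mtopology (carrier (padic_int p)) (padic_dist p)"

definition is_padic_haar :: "nat \<Rightarrow> (nat \<Rightarrow> int) measure \<Rightarrow> bool" where
  "is_padic_haar p \<mu> \<longleftrightarrow>
    prob_space \<mu> \<and>
    space \<mu> = carrier (padic_int p) \<and>
    sets \<mu> = sigma_sets (carrier (padic_int p)) {U. openin (padic_topology p) U} \<and>
    (\<forall>a \<in> carrier (padic_int p). \<forall>A \<in> sets \<mu>.
       emeasure \<mu> ((\<lambda>x. a \<oplus>\<^bsub>padic_int p\<^esub> x) ` A) = emeasure \<mu> A)"

definition padic_haar :: "nat \<Rightarrow> (nat \<Rightarrow> int) measure" where
  "padic_haar p = (THE \<mu>. is_padic_haar p \<mu>)"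

(* The suprema are over nonempty sets of reals in [0,1] and decrease with L, so both Sup and lim
   are meaningful for every E (for L = 0 the empty interval contributes the harmless 0 / 0 = 0). *)
definition upper_banach_density :: "int set \<Rightarrow> real" where
  "upper_banach_density E =
    lim (\<lambda>L::nat. SUP (M, N) \<in> {(M, N). int L \<le> N - M}.
          real (card (E \<inter> {M<..N})) / real_of_int (N - M))"


context
  fixes p :: nat
  assumes prime_p: "prime p"
begin

lemma p_gt_1: "int p > 1"
  using prime_gt_1_nat[OF prime_p] by simp

lemma p_pow_pos: "int p ^ n > 0"
  using p_gt_1 by simp

lemma padic_carrier_iff: "x \<in> carrier (padic_int p) \<longleftrightarrow> (\<forall>n. x (Suc n) mod int p ^ n = x n)"
  by (simp add: padic_int_def)

lemma mod_pow_Suc: "(a mod int p ^ Suc n) mod int p ^ n = a mod int p ^ n"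
  by (simp add: mod_mod_cancel le_imp_power_dvd)

lemma padic_mem_mod:
  assumes "x \<in> carrier (padic_int p)" shows "x n mod int p ^ n = x n"
  using assms unfolding padic_carrier_iff by (metis mod_mod_trivial)

lemma padic_mem_mod_le:
  assumes "x \<in> carrier (padic_int p)" "m \<le> n" shows "x n mod int p ^ m = x m"
  using assms(2)
proof (induction rule: dec_induct)
  case base
  show ?case using padic_mem_mod[OF assms(1)] .
next
  case (step n)
  have "x (Suc n) mod int p ^ m = (x (Suc n) mod int p ^ n) mod int p ^ m"
    using step by (simp add: mod_mod_cancel le_imp_power_dvd)
  then show ?case using step assms(1) unfolding padic_carrier_iff by simp
qed

lemma cring_padic_int: "cring (padic_int p)"
proof -
  have c: "x \<in> carrier (padic_int p)" if "\<And>n. x (Suc n) mod int p ^ n = x n" for x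
    using that by (simp add: padic_carrier_iff)
  have ag: "abelian_group (padic_int p)"
  proof (rule abelian_groupI)
    fix x y assume xy: "x \<in> carrier (padic_int p)" "y \<in> carrier (padic_int p)"
    show "x \<oplus>\<^bsub>padic_int p\<^esub> y \<in> carrier (padic_int p)"
    proof (rule c)
      fix n
      have "(x (Suc n) + y (Suc n)) mod int p ^ n = (x n + y n) mod int p ^ n"
        using xy by (metis mod_add_eq padic_carrier_iff)
      then show "(x \<oplus>\<^bsub>padic_int p\<^esub> y) (Suc n) mod int p ^ n = (x \<oplus>\<^bsub>padic_int p\<^esub> y) n"
        unfolding padic_int_def by (simp add: mod_pow_Suc del: power_Suc)
    qed
  next
    fix x assume x: "x \<in> carrier (padic_int p)"
    show "\<exists>y\<in>carrier (padic_int p). y \<oplus>\<^bsub>padic_int p\<^esub> x = \<zero>\<^bsub>padic_int p\<^esub>"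
    proof (intro bexI[of _ "\<lambda>n. (- x n) mod int p ^ n"])
      show "(\<lambda>n. (- x n) mod int p ^ n) \<in> carrier (padic_int p)"
      proof (rule c)
        fix n
        have "(- x (Suc n)) mod int p ^ n = (- x n) mod int p ^ n"
          using x by (metis mod_minus_eq padic_carrier_iff)
        then show "(- x (Suc n)) mod int p ^ Suc n mod int p ^ n = (- x n) mod int p ^ n"
          by (simp add: mod_pow_Suc del: power_Suc)
      qed
    qed (simp add: padic_int_def mod_simps)
    show "\<zero>\<^bsub>padic_int p\<^esub> \<oplus>\<^bsub>padic_int p\<^esub> x = x"
      using padic_mem_mod[OF x] by (simp add: padic_int_def)
  qed (auto simp: padic_int_def mod_simps algebra_simps)
  show ?thesis
  proof (rule cringI[OF ag])
    show "Group.comm_monoid (padic_int p)"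
    proof (rule comm_monoidI)
      fix x y assume xy: "x \<in> carrier (padic_int p)" "y \<in> carrier (padic_int p)"
      show "x \<otimes>\<^bsub>padic_int p\<^esub> y \<in> carrier (padic_int p)"
      proof (rule c)
        fix n
        have "(x (Suc n) * y (Suc n)) mod int p ^ n = (x n * y n) mod int p ^ n"
          using xy by (metis mod_mult_eq padic_carrier_iff)
        then show "(x \<otimes>\<^bsub>padic_int p\<^esub> y) (Suc n) mod int p ^ n = (x \<otimes>\<^bsub>padic_int p\<^esub> y) n"
          unfolding padic_int_def by (simp add: mod_pow_Suc del: power_Suc)
      qed
    next
      show "\<one>\<^bsub>padic_int p\<^esub> \<in> carrier (padic_int p)"
        by (rule c) (simp add: padic_int_def mod_pow_Suc del: power_Suc)
    next
      fix x assume x: "x \<in> carrier (padic_int p)"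
      show "\<one>\<^bsub>padic_int p\<^esub> \<otimes>\<^bsub>padic_int p\<^esub> x = x"
        using padic_mem_mod[OF x] by (simp add: padic_int_def mod_simps)
    qed (auto simp: padic_int_def mod_simps algebra_simps)
  qed (auto simp: padic_int_def mod_simps algebra_simps)
qed

interpretation Zp: cring "padic_int p"
  by (rule cring_padic_int)

lemma padic_add_apply: "(x \<oplus>\<^bsub>padic_int p\<^esub> y) n = (x n + y n) mod int p ^ n"
  by (simp add: padic_int_def)

lemma padic_zero_apply: "\<zero>\<^bsub>padic_int p\<^esub> n = 0"
  by (simp add: padic_int_def)

lemma padic_minus_apply:
  assumes "x \<in> carrier (padic_int p)" "y \<in> carrier (padic_int p)"
  shows "(x \<ominus>\<^bsub>padic_int p\<^esub> y) n = (x n - y n) mod int p ^ n"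
proof -
  let ?z = "x \<ominus>\<^bsub>padic_int p\<^esub> y"
  have z: "?z \<in> carrier (padic_int p)" "?z \<oplus>\<^bsub>padic_int p\<^esub> y = x"
    using assms by (auto simp: Zp.minus_eq Zp.a_assoc Zp.l_neg)
  have "(?z n + y n) mod int p ^ n = x n"
    using z(2) by (metis padic_add_apply)
  then have "(x n - y n) mod int p ^ n = ?z n mod int p ^ n"
    by (metis add_diff_cancel_right' mod_diff_left_eq)
  then show ?thesis using padic_mem_mod[OF z(1)] by simp
qed

lemma padic_norm_le_iff:
  assumes x: "x \<in> carrier (padic_int p)"
  shows "padic_norm p x \<le> 1 / real p ^ n \<longleftrightarrow> x n = 0"
proof (cases "x = \<zero>\<^bsub>padic_int p\<^esub>")
  case True
  then show ?thesis by (simp add: padic_norm_def padic_zero_apply)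
next
  case False
  then obtain k where k: "x k \<noteq> 0"
    by (metis ext padic_zero_apply)
  have mono: "x m = 0" if "x n = 0" "m \<le> n" for m n
    using padic_mem_mod_le[OF x that(2)] that(1) by simp
  have x0: "x 0 = 0" using padic_mem_mod[OF x, of 0] by simp
  define v where "v = (GREATEST n. x n = 0)"
  have b: "m \<le> k" if "x m = 0" for m using mono k that nat_le_linear by blast
  have v: "x v = 0" unfolding v_def by (rule GreatestI_nat[of _ 0 k]) (use x0 b in auto)
  have vm: "m \<le> v" if "x m = 0" for m
    unfolding v_def by (rule Greatest_le_nat[of _ m k]) (use that b in auto)
  have "padic_norm p x \<le> 1 / real p ^ n \<longleftrightarrow> real p ^ n \<le> real p ^ v"
    using False p_gt_1 by (simp add: padic_norm_def v_def[symmetric] frac_le_eq divide_simps)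
  also have "\<dots> \<longleftrightarrow> n \<le> v" using p_gt_1 by simp
  also have "\<dots> \<longleftrightarrow> x n = 0" using v vm mono by blast
  finally show ?thesis .
qed

lemma padic_dist_le_iff:
  assumes "x \<in> carrier (padic_int p)" "y \<in> carrier (padic_int p)"
  shows "padic_dist p x y \<le> 1 / real p ^ n \<longleftrightarrow> x n = y n"
proof -
  have "padic_dist p x y \<le> 1 / real p ^ n \<longleftrightarrow> (x n - y n) mod int p ^ n = 0"
    unfolding padic_dist_def using assms by (simp add: padic_norm_le_iff padic_minus_apply)
  also have "\<dots> \<longleftrightarrow> x n mod int p ^ n = y n mod int p ^ n"
    by (simp add: mod_eq_dvd_iff dvd_eq_mod_eq_0)
  finally show ?thesis using assms by (simp add: padic_mem_mod)
qed

lemma padic_dist_cases: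
  obtains "padic_dist p x y = 0" | n where "padic_dist p x y = 1 / real p ^ n"
proof -
  have "padic_dist p x y = 0 \<or> (\<exists>n. padic_dist p x y = 1 / real p ^ n)"
    by (auto simp: padic_dist_def padic_norm_def)
  then show thesis using that by blast
qed

lemma Metric_space_padic: "Metric_space (carrier (padic_int p)) (padic_dist p)"
proof
  show "0 \<le> padic_dist p x y" for x y
    by (simp add: padic_dist_def padic_norm_def)
  have pos: "1 / real p ^ n > 0" for n using p_gt_1 by simp
  have le: "padic_dist p x y \<le> padic_dist p z w"
    if c: "x \<in> carrier (padic_int p)" "y \<in> carrier (padic_int p)" "z \<in> carrier (padic_int p)"
      "w \<in> carrier (padic_int p)" and *: "\<And>n. z n = w n \<Longrightarrow> x n = y n" for x y z w
  proof (cases rule: padic_dist_cases[of z w])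
    case 1
    have "z n = w n" for n using padic_dist_le_iff[OF c(3,4), of n] 1 by simp
    then have "x = y" using * by blast
    then show ?thesis using 1 c by (simp add: padic_dist_def padic_norm_def Zp.r_neg Zp.minus_eq)
  next
    case (2 n)
    then show ?thesis using * padic_dist_le_iff c by (metis order_refl)
  qed
  have sym: "padic_dist p x y = padic_dist p y x"
    if "x \<in> carrier (padic_int p)" "y \<in> carrier (padic_int p)" for x y
    by (intro antisym le) (use that in auto)
  have nz: "padic_dist p x y = 0 \<longleftrightarrow> x = y"
    if c: "x \<in> carrier (padic_int p)" "y \<in> carrier (padic_int p)" for x y
  proof
    assume "padic_dist p x y = 0"
    then have "x n = y n" for n using padic_dist_le_iff[OF c, of n] by simp
    then show "x = y" by blast
  qed (use c in \<open>simp add: padic_dist_def padic_norm_def Zp.r_neg Zp.minus_eq\<close>)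
  show "padic_dist p x y = padic_dist p y x" for x y
  proof (cases "x \<in> carrier (padic_int p) \<and> y \<in> carrier (padic_int p)")
    case True then show ?thesis using sym by blast
  next
    case False
    then show ?thesis by (auto simp: padic_dist_def)
  qed
  show "padic_dist p x y = 0 \<longleftrightarrow> x = y"
    if "x \<in> carrier (padic_int p)" "y \<in> carrier (padic_int p)" for x y
    using nz that .
  show "padic_dist p x z \<le> padic_dist p x y + padic_dist p y z"
    if c: "x \<in> carrier (padic_int p)" "y \<in> carrier (padic_int p)" "z \<in> carrier (padic_int p)" for x y z
  proof -
    have "padic_dist p x z \<le> padic_dist p x y \<or> padic_dist p x z \<le> padic_dist p y z"
    proof (cases rule: padic_dist_cases[of x y])
      case 1 then show ?thesis using nz c by auto
    next
      case (2 n)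
      note xy = 2
      show ?thesis
      proof (cases rule: padic_dist_cases[of y z])
        case 1 then show ?thesis using nz c by auto
      next
        case (2 m)
        have "x n = y n" "y m = z m" using xy 2 c padic_dist_le_iff by (metis order_refl)+
        then have "x (min m n) = z (min m n)"
          using padic_mem_mod_le c by (metis min.cobounded1 min.cobounded2)
        then show ?thesis using xy 2 c padic_dist_le_iff by (metis min_def)
      qed
    qed
    then show ?thesis by (smt (verit) pos padic_dist_cases)
  qed
qed


interpretation Zm: Metric_space "carrier (padic_int p)" "padic_dist p"
  by (rule Metric_space_padic)

lemma topspace_padic_topology: "topspace (padic_topology p) = carrier (padic_int p)"
  by (simp add: padic_topology_def)

definition padic_cyl :: "nat \<Rightarrow> int \<Rightarrow> (nat \<Rightarrow> int) set" where
  "padic_cyl n c = {x \<in> carrier (padic_int p). x n = c}"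

lemma padic_mem_range:
  assumes "x \<in> carrier (padic_int p)" shows "x n \<in> {0..<int p ^ n}"
  using padic_mem_mod[OF assms, of n] p_pow_pos[of n]
  by (metis atLeastLessThan_iff pos_mod_bound pos_mod_sign)

lemma padic_cyl_eq_mcball:
  assumes "x \<in> carrier (padic_int p)"
  shows "padic_cyl n (x n) = Zm.mcball x (1 / real p ^ n)"
  using padic_dist_le_iff[OF assms] assms by (auto simp: padic_cyl_def)

lemma openin_padic_cyl: "openin (padic_topology p) (padic_cyl n c)"
  unfolding padic_topology_def Zm.openin_mtopology
proof (intro conjI allI impI)
  fix x assume "x \<in> padic_cyl n c"
  then have x: "x \<in> carrier (padic_int p)" "x n = c" by (auto simp: padic_cyl_def)
  have "Zm.mball x (1 / real p ^ n) \<subseteq> padic_cyl n c"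
    using padic_cyl_eq_mcball[OF x(1), of n] x(2) Zm.mball_subset_mcball by blast
  then show "\<exists>r>0. Zm.mball x r \<subseteq> padic_cyl n c"
    using p_gt_1 by (intro exI[of _ "1 / real p ^ n"]) auto
qed (auto simp: padic_cyl_def)

lemma padic_open_cyl:
  assumes "openin (padic_topology p) U" "x \<in> U"
  obtains n where "padic_cyl n (x n) \<subseteq> U"
proof -
  from assms obtain r where r: "r > 0" "Zm.mball x r \<subseteq> U" and U: "U \<subseteq> carrier (padic_int p)"
    unfolding padic_topology_def Zm.openin_mtopology by blast
  have x: "x \<in> carrier (padic_int p)" using U assms by blast
  obtain n where "(1 / real p) ^ n < r"
    using real_arch_pow_inv[OF r(1), of "1 / real p"] p_gt_1 by auto
  then have "1 / real p ^ n < r" by (simp add: power_one_over)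
  then have "padic_cyl n (x n) \<subseteq> Zm.mball x r"
    using padic_cyl_eq_mcball[OF x, of n] by auto
  then show ?thesis using that r by blast
qed

lemma padic_borel_eq:
  "sigma_sets (carrier (padic_int p)) {U. openin (padic_topology p) U} =
   sigma_sets (carrier (padic_int p)) (insert {} (range (\<lambda>(n, c). padic_cyl n c)))"
  (is "sigma_sets ?\<Omega> ?O = sigma_sets ?\<Omega> ?C")
proof (rule sigma_sets_eqI)
  fix U assume "U \<in> ?O"
  then have U: "openin (padic_topology p) U" by simp
  let ?I = "{i. (\<lambda>(n, c). padic_cyl n c) i \<subseteq> U}"
  have "U \<subseteq> (\<Union>i\<in>?I. (\<lambda>(n, c). padic_cyl n c) i)"
  proof
    fix x assume x: "x \<in> U"
    then obtain n where n: "padic_cyl n (x n) \<subseteq> U" using U padic_open_cyl by blast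
    have "x \<in> carrier (padic_int p)"
      using openin_subset[OF U] x by (auto simp: topspace_padic_topology)
    then have "x \<in> padic_cyl n (x n)" by (simp add: padic_cyl_def)
    then show "x \<in> (\<Union>i\<in>?I. (\<lambda>(n, c). padic_cyl n c) i)" using n by blast
  qed
  then have eq: "U = \<Union> ((\<lambda>(n, c). padic_cyl n c) ` ?I)" by blast
  show "U \<in> sigma_sets ?\<Omega> ?C"
    by (subst eq, rule sigma_sets_UNION) (auto intro!: sigma_sets.Basic)
next
  fix A assume "A \<in> ?C"
  then show "A \<in> sigma_sets ?\<Omega> ?O"
    by (auto intro!: sigma_sets.Basic openin_padic_cyl)
qed

lemma padic_cyl_0: "padic_cyl 0 0 = carrier (padic_int p)"
  using padic_mem_range[where n = 0] by (fastforce simp: padic_cyl_def)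

lemma padic_cyl_empty: "c \<notin> {0..<int p ^ n} \<Longrightarrow> padic_cyl n c = {}"
  using padic_mem_range by (auto simp: padic_cyl_def)

lemma padic_cyl_Int:
  "padic_cyl m c \<inter> padic_cyl n d \<in> insert {} (range (\<lambda>(n, c). padic_cyl n c))"
proof -
  have *: "padic_cyl m c \<inter> padic_cyl n d \<in> insert {} (range (\<lambda>(n, c). padic_cyl n c))"
    if "m \<le> n" for m n c d
  proof (cases "padic_cyl m c \<inter> padic_cyl n d = {}")
    case False
    then obtain x where "x \<in> padic_cyl m c" "x \<in> padic_cyl n d" by blast
    then have "d mod int p ^ m = c"
      using padic_mem_mod_le[OF _ that] by (auto simp: padic_cyl_def)
    then have "padic_cyl n d \<subseteq> padic_cyl m c"
      using padic_mem_mod_le[OF _ that] by (auto simp: padic_cyl_def)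
    then have "padic_cyl m c \<inter> padic_cyl n d = (\<lambda>(n, c). padic_cyl n c) (n, d)" by auto
    then show ?thesis by blast
  qed auto
  show ?thesis
  proof (cases "m \<le> n")
    case True then show ?thesis by (rule *)
  next
    case False
    then have "n \<le> m" by simp
    from *[OF this, of d c] show ?thesis by (simp only: Int_commute)
  qed
qed

lemma padic_measure_eqI:
  fixes M N :: "(nat \<Rightarrow> int) measure"
  assumes M: "sets M = sigma_sets (carrier (padic_int p)) {U. openin (padic_topology p) U}"
    and N: "sets N = sigma_sets (carrier (padic_int p)) {U. openin (padic_topology p) U}"
    and fin: "emeasure M (carrier (padic_int p)) \<noteq> \<infinity>"
    and eq: "\<And>n c. c \<in> {0..<int p ^ n} \<Longrightarrow> emeasure M (padic_cyl n c) = emeasure N (padic_cyl n c)"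
  shows "M = N"
proof (rule measure_eqI_generator_eq)
  show "Int_stable (insert {} (range (\<lambda>(n, c). padic_cyl n c)))"
    unfolding Int_stable_def using padic_cyl_Int by fastforce
  show "insert {} (range (\<lambda>(n, c). padic_cyl n c)) \<subseteq> Pow (carrier (padic_int p))"
    by (auto simp: padic_cyl_def)
  show "emeasure M X = emeasure N X" if X: "X \<in> insert {} (range (\<lambda>(n, c). padic_cyl n c))" for X
  proof (cases "X = {}")
    case False
    with X obtain n c where X: "X = padic_cyl n c" by auto
    with False have "c \<in> {0..<int p ^ n}" using padic_cyl_empty by blast
    then show ?thesis using eq X by blast
  qed simp
  show "range (\<lambda>_::nat. padic_cyl 0 0) \<subseteq> insert {} (range (\<lambda>(n, c). padic_cyl n c))" by auto
  show "(\<Union>i::nat. padic_cyl 0 0) = carrier (padic_int p)" by (simp add: padic_cyl_0)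
  show "emeasure M (padic_cyl 0 0) \<noteq> \<infinity>" using fin by (simp add: padic_cyl_0)
qed (use M N padic_borel_eq in auto)

lemma padic_of_int_mem: "padic_of_int p k \<in> carrier (padic_int p)"
  by (simp add: padic_carrier_iff padic_of_int_def mod_pow_Suc del: power_Suc)

lemma padic_translate_vimage:
  assumes b: "b \<in> carrier (padic_int p)" and c: "c \<in> {0..<int p ^ n}"
  shows "(\<lambda>x. b \<oplus>\<^bsub>padic_int p\<^esub> x) -` padic_cyl n c \<inter> carrier (padic_int p) =
    padic_cyl n ((c - b n) mod int p ^ n)"
proof -
  have "(b n + x n) mod int p ^ n = c \<longleftrightarrow> x n = (c - b n) mod int p ^ n"
    if x: "x \<in> carrier (padic_int p)" for x
  proof -
    have "c mod int p ^ n = c" using c by simp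
    then show ?thesis using padic_mem_mod[OF x, of n]
      by (metis add.commute add_diff_cancel_left' diff_add_cancel mod_add_left_eq mod_diff_left_eq)
  qed
  then show ?thesis using b by (auto simp: padic_cyl_def padic_add_apply)
qed

lemma padic_translate_image:
  assumes a: "a \<in> carrier (padic_int p)" and A: "A \<subseteq> carrier (padic_int p)"
  shows "(\<lambda>x. a \<oplus>\<^bsub>padic_int p\<^esub> x) ` A =
    (\<lambda>x. (\<ominus>\<^bsub>padic_int p\<^esub> a) \<oplus>\<^bsub>padic_int p\<^esub> x) -` A \<inter> carrier (padic_int p)"
proof (intro equalityI subsetI)
  fix y assume "y \<in> (\<lambda>x. (\<ominus>\<^bsub>padic_int p\<^esub> a) \<oplus>\<^bsub>padic_int p\<^esub> x) -` A \<inter> carrier (padic_int p)"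
  then have "(\<ominus>\<^bsub>padic_int p\<^esub> a) \<oplus>\<^bsub>padic_int p\<^esub> y \<in> A" "y \<in> carrier (padic_int p)" by auto
  then show "y \<in> (\<lambda>x. a \<oplus>\<^bsub>padic_int p\<^esub> x) ` A"
    using a by (intro image_eqI[of _ _ "(\<ominus>\<^bsub>padic_int p\<^esub> a) \<oplus>\<^bsub>padic_int p\<^esub> y"])
      (auto simp: Zp.r_neg2)
qed (use a A in \<open>auto simp: Zp.r_neg1\<close>)

lemma padic_haar_cyl:
  assumes h: "is_padic_haar p \<mu>" and c: "c \<in> {0..<int p ^ n}"
  shows "emeasure \<mu> (padic_cyl n c) = ennreal (1 / real p ^ n)"
proof -
  interpret prob_space \<mu> using h by (simp add: is_padic_haar_def)
  have meas: "padic_cyl n c \<in> sets \<mu>" for c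
    using h openin_padic_cyl by (auto simp: is_padic_haar_def)
  have eq: "measure \<mu> (padic_cyl n c) = measure \<mu> (padic_cyl n 0)" if c: "c \<in> {0..<int p ^ n}" for c
  proof -
    let ?a = "\<ominus>\<^bsub>padic_int p\<^esub> padic_of_int p c"
    have a: "?a \<in> carrier (padic_int p)" using padic_of_int_mem by simp
    have "(\<lambda>x. ?a \<oplus>\<^bsub>padic_int p\<^esub> x) ` padic_cyl n c =
      (\<lambda>x. padic_of_int p c \<oplus>\<^bsub>padic_int p\<^esub> x) -` padic_cyl n c \<inter> carrier (padic_int p)"
      by (subst padic_translate_image[OF a]) (auto simp: padic_cyl_def padic_of_int_mem)
    also have "\<dots> = padic_cyl n 0"
      using padic_translate_vimage[OF padic_of_int_mem c] c by (simp add: padic_of_int_def)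
    finally have "emeasure \<mu> (padic_cyl n c) = emeasure \<mu> (padic_cyl n 0)"
      using h a meas unfolding is_padic_haar_def by metis
    then show ?thesis by (simp add: measure_def)
  qed
  have "1 = measure \<mu> (\<Union>c\<in>{0..<int p ^ n}. padic_cyl n c)"
  proof -
    have "(\<Union>c\<in>{0..<int p ^ n}. padic_cyl n c) = space \<mu>"
      using h padic_mem_range by (auto simp: is_padic_haar_def padic_cyl_def)
    then show ?thesis by (simp add: prob_space)
  qed
  also have "\<dots> = (\<Sum>c\<in>{0..<int p ^ n}. measure \<mu> (padic_cyl n c))"
    by (rule finite_measure_finite_Union)
      (use meas in \<open>auto simp: disjoint_family_on_def padic_cyl_def\<close>)
  also have "\<dots> = real p ^ n * measure \<mu> (padic_cyl n 0)"
    using eq by (simp add: nat_power_eq)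
  finally have "measure \<mu> (padic_cyl n 0) = 1 / real p ^ n"
    using p_gt_1 by (simp add: field_simps)
  then show ?thesis using eq[OF c] by (simp add: emeasure_eq_measure)
qed

lemma ex_padic_haar: "\<exists>\<mu>. is_padic_haar p \<mu>"
proof -
  let ?\<Omega> = "carrier (padic_int p)"
  let ?O = "{U. openin (padic_topology p) U}"
  let ?C = "insert {} (range (\<lambda>(n, c). padic_cyl n c))"
  define B where "B = sigma ?\<Omega> ?O"
  have OPow: "?O \<subseteq> Pow ?\<Omega>"
    using openin_subset by (fastforce simp: topspace_padic_topology)
  have B: "space B = ?\<Omega>" "sets B = sigma_sets ?\<Omega> ?O"
    using OPow by (auto simp: B_def space_measure_of_conv sets_measure_of)
  have B_C: "sets B = sigma_sets ?\<Omega> ?C" using B padic_borel_eq by simp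
  have CPow: "?C \<subseteq> Pow ?\<Omega>" by (auto simp: padic_cyl_def)
  have meas_B: "f \<in> measurable M B"
    if f: "\<And>x. x \<in> space M \<Longrightarrow> f x \<in> ?\<Omega>"
      and c: "\<And>n c. c \<in> {0..<int p ^ n} \<Longrightarrow> f -` padic_cyl n c \<inter> space M \<in> sets M"
    for M :: "(nat \<Rightarrow> int) measure" and f
  proof (rule measurable_sigma_sets[OF B_C CPow])
    fix y assume "y \<in> ?C"
    then show "f -` y \<inter> space M \<in> sets M"
      using c padic_cyl_empty by (cases "y = {}") (auto, metis vimage_empty Int_empty_left sets.empty_sets)
  qed (use f in auto)

  define D where "D = PiM (UNIV :: nat set) (\<lambda>_. uniform_count_measure {0..<int p})"
  have ps: "prob_space (uniform_count_measure {0..<int p})"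
    by (rule prob_space_uniform_count_measure) (use p_gt_1 in auto)
  interpret D: product_prob_space "\<lambda>_. uniform_count_measure {0..<int p}" "UNIV :: nat set"
    by (simp add: product_prob_space_def product_prob_space_axioms_def product_sigma_finite_def ps
        prob_space_imp_sigma_finite)
  have spD: "space D = {\<omega>. \<forall>i. \<omega> i \<in> {0..<int p}}"
    by (auto simp: D_def space_PiM space_uniform_count_measure)
  define X where "X \<omega> n = (\<Sum>i<n. \<omega> i * int p ^ i)" for \<omega> n
  have XS: "X \<omega> (Suc n) = X \<omega> n + \<omega> n * int p ^ n" for \<omega> n by (simp add: X_def)
  have Xr: "X \<omega> n \<in> {0..<int p ^ n}" if "\<omega> \<in> space D" for \<omega> n
  proof (induction n)
    case (Suc n)
    have w: "0 \<le> \<omega> n" "\<omega> n \<le> int p - 1" using that by (auto simp: spD)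
    have "\<omega> n * int p ^ n \<le> (int p - 1) * int p ^ n" using w by (intro mult_right_mono) auto
    then show ?case using Suc w unfolding XS by (simp add: algebra_simps)
  qed (simp add: X_def)
  have Xc: "X \<omega> \<in> ?\<Omega>" if "\<omega> \<in> space D" for \<omega>
    using Xr[OF that] by (simp add: padic_carrier_iff XS)
  have digits: "\<exists>s. (\<forall>i. s i \<in> {0..<int p}) \<and> (\<forall>\<omega>\<in>space D. X \<omega> n = c \<longleftrightarrow> (\<forall>i<n. \<omega> i = s i))"
    if "c \<in> {0..<int p ^ n}" for n c
    using that
  proof (induction n arbitrary: c)
    case 0
    then show ?case using p_gt_1 by (intro exI[of _ "\<lambda>_. 0"]) (auto simp: X_def)
  next
    case (Suc n)
    have "c mod int p ^ n \<in> {0..<int p ^ n}" using p_pow_pos[of n] by simp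
    from Suc.IH[OF this] obtain s where s: "\<And>i. s i \<in> {0..<int p}"
      "\<And>\<omega>. \<omega> \<in> space D \<Longrightarrow> X \<omega> n = c mod int p ^ n \<longleftrightarrow> (\<forall>i<n. \<omega> i = s i)" by blast
    have d: "c div int p ^ n \<in> {0..<int p}"
    proof -
      have "c div int p ^ n < int p"
      proof (rule ccontr)
        assume "\<not> c div int p ^ n < int p"
        then have "int p * int p ^ n \<le> (c div int p ^ n) * int p ^ n"
          by (intro mult_right_mono) auto
        also have "\<dots> \<le> c"
          using pos_mod_sign[OF p_pow_pos[of n], of c] div_mult_mod_eq[of c "int p ^ n"] by linarith
        finally show False using Suc.prems by simp
      qed
      then show ?thesis
        using Suc.prems pos_imp_zdiv_nonneg_iff[OF p_pow_pos[of n], of c] by simp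
    qed
    have "X \<omega> (Suc n) = c \<longleftrightarrow> (\<forall>i<Suc n. \<omega> i = (s(n := c div int p ^ n)) i)"
      if w: "\<omega> \<in> space D" for \<omega>
    proof -
      have "X \<omega> (Suc n) = c \<longleftrightarrow> X \<omega> n = c mod int p ^ n \<and> \<omega> n = c div int p ^ n"
        using Xr[OF w, of n] p_pow_pos[of n] mod_mult_div_eq[of c "int p ^ n"] unfolding XS
        by (auto simp: mult.commute div_pos_pos_trivial)
      then show ?thesis using s(2)[OF w] by (auto simp: less_Suc_eq)
    qed
    then show ?case using s(1) d by (intro exI[of _ "s(n := c div int p ^ n)"]) auto
  qed
  have cyl: "X -` padic_cyl n c \<inter> space D \<in> sets D \<and>
      emeasure D (X -` padic_cyl n c \<inter> space D) = ennreal (1 / real p ^ n)"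
    if c: "c \<in> {0..<int p ^ n}" for n c
  proof -
    obtain s where s: "\<And>i. s i \<in> {0..<int p}"
      "\<And>\<omega>. \<omega> \<in> space D \<Longrightarrow> X \<omega> n = c \<longleftrightarrow> (\<forall>i<n. \<omega> i = s i)" using digits[OF c] by blast
    let ?M = "\<lambda>_::nat. uniform_count_measure {0..<int p}"
    have eq: "X -` padic_cyl n c \<inter> space D = prod_emb UNIV ?M {..<n} (PiE {..<n} (\<lambda>i. {s i}))"
    proof -
      have "prod_emb UNIV ?M {..<n} (PiE {..<n} (\<lambda>i. {s i})) = {\<omega>\<in>space D. \<forall>i<n. \<omega> i = s i}"
        by (auto simp: prod_emb_def space_PiM D_def PiE_iff extensional_def restrict_def)
      also have "\<dots> = X -` padic_cyl n c \<inter> space D"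
        using s(2) Xc by (auto simp: padic_cyl_def)
      finally show ?thesis by simp
    qed
    have S: "{s i} \<in> sets (uniform_count_measure {0..<int p})" for i
      using s(1) by (simp add: sets_uniform_count_measure)
    have "emeasure D (X -` padic_cyl n c \<inter> space D) =
        (\<Prod>i<n. emeasure (uniform_count_measure {0..<int p}) {s i})"
      unfolding eq unfolding D_def by (rule D.emeasure_PiM_emb) (use S in auto)
    also have "\<dots> = (\<Prod>i<n. ennreal (1 / real p))"
      by (intro prod.cong refl) (use s(1) in \<open>simp add: emeasure_uniform_count_measure\<close>)
    also have "\<dots> = ennreal (1 / real p ^ n)"
      by (simp add: ennreal_power power_one_over)
    finally show ?thesis
      unfolding eq unfolding D_def using S by (auto intro!: sets_PiM_I)
  qed
  have X: "X \<in> measurable D B" by (rule meas_B) (use Xc cyl in auto)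
  define \<mu> where "\<mu> = distr D B X"
  have cylB: "padic_cyl n c \<in> sets B" for n c
    unfolding B by (auto intro!: sigma_sets.Basic openin_padic_cyl)
  have \<mu>c: "emeasure \<mu> (padic_cyl n c) = ennreal (1 / real p ^ n)" if "c \<in> {0..<int p ^ n}" for n c
    unfolding \<mu>_def using cyl[OF that] by (simp add: emeasure_distr[OF X cylB])
  have \<mu>: "space \<mu> = ?\<Omega>" "sets \<mu> = sets B" by (auto simp: \<mu>_def B)
  have prob: "prob_space \<mu>"
    unfolding \<mu>_def using D.prob_space_distr X unfolding D_def by blast
  have inv: "emeasure \<mu> ((\<lambda>x. a \<oplus>\<^bsub>padic_int p\<^esub> x) ` A) = emeasure \<mu> A"
    if a: "a \<in> ?\<Omega>" and A: "A \<in> sets \<mu>" for a A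
  proof -
    let ?T = "\<lambda>x. (\<ominus>\<^bsub>padic_int p\<^esub> a) \<oplus>\<^bsub>padic_int p\<^esub> x"
    have a': "\<ominus>\<^bsub>padic_int p\<^esub> a \<in> ?\<Omega>" using a by simp
    have T: "?T \<in> measurable \<mu> B"
      by (rule meas_B) (use a' padic_translate_vimage[OF a'] \<mu> cylB in auto)
    have "\<mu> = distr \<mu> B ?T"
    proof (rule padic_measure_eqI)
      show "emeasure \<mu> ?\<Omega> \<noteq> \<infinity>" using prob \<mu> prob_space.emeasure_space_1 by fastforce
      fix n c assume c: "c \<in> {0..<int p ^ n}"
      show "emeasure \<mu> (padic_cyl n c) = emeasure (distr \<mu> B ?T) (padic_cyl n c)"
        using c p_pow_pos[of n] padic_translate_vimage[OF a' c] \<mu>(1)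
        by (simp add: emeasure_distr[OF T cylB] \<mu>c)
    qed (use \<mu> B in auto)
    then have "emeasure \<mu> A = emeasure (distr \<mu> B ?T) A" by simp
    also have "\<dots> = emeasure \<mu> (?T -` A \<inter> ?\<Omega>)" using A \<mu> by (simp add: emeasure_distr[OF T])
    also have "?T -` A \<inter> ?\<Omega> = (\<lambda>x. a \<oplus>\<^bsub>padic_int p\<^esub> x) ` A"
      using padic_translate_image[OF a] sets.sets_into_space[OF A] \<mu> by simp
    finally show ?thesis by simp
  qed
  have "is_padic_haar p \<mu>"
    using prob \<mu> B inv by (auto simp: is_padic_haar_def)
  then show ?thesis by blast
qed

lemma is_padic_haar_padic_haar: "is_padic_haar p (padic_haar p)"
  unfolding padic_haar_def
proof (rule theI')
  have "M = N" if "is_padic_haar p M" "is_padic_haar p N" for M N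
  proof (rule padic_measure_eqI)
    show "emeasure M (carrier (padic_int p)) \<noteq> \<infinity>"
      using that prob_space.emeasure_space_1 by (fastforce simp: is_padic_haar_def)
  qed (use that padic_haar_cyl in \<open>auto simp: is_padic_haar_def\<close>)
  then show "\<exists>!\<mu>. is_padic_haar p \<mu>" using ex_padic_haar by blast
qed

lemma padic_haar_mcball:
  assumes "x \<in> carrier (padic_int p)"
  shows "measure (padic_haar p)
    (Metric_space.mcball (carrier (padic_int p)) (padic_dist p) x (1 / real p ^ n)) = 1 / real p ^ n"
  using padic_haar_cyl[OF is_padic_haar_padic_haar padic_mem_range[OF assms]]
  unfolding padic_cyl_eq_mcball[OF assms] by (simp add: measure_def)

end
end

(* A closed F is the decreasing intersection of its neighbourhoods C n, the unions of the cylinders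
   modulo p^n that meet F.  Membership of an integer in C n is a congruence condition modulo p^n,
   so the frequency of C n in long intervals tends to its measure, uniformly in the interval; this
   bounds the frequency of F from above.  The lower bound is the upper bound applied to the closed
   complement of the interior of F. *)
theory Submission
  imports Defs
begin

section \<open>Counting integers of given residues in an interval\<close>

text \<open>Writing \<open>k = c + int q * j\<close> turns the count into one of integers
  \<open>j\<close> in a half-open interval whose endpoints are the floors of
  \<open>(M - c) / q\<close> and \<open>(N - c) / q\<close>. Rounding changes the length
  \<open>(N - M) / q\<close> by at most 1.\<close>

lemma card_residue_class_le:
  fixes q :: nat and c M N :: int
  assumes "q > 0" "M \<le> N"
  shows "real (card {k \<in> {M<..N}. k mod int q = c}) \<le> real_of_int (N - M) / q + 1"
proof -
  let ?a = "(M - c) div int q" and ?b = "(N - c) div int q"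
  have "{k \<in> {M<..N}. k mod int q = c} \<subseteq> (\<lambda>j. c + int q * j) ` {?a<..?b}"
  proof
    fix k assume k: "k \<in> {k \<in> {M<..N}. k mod int q = c}"
    define j where "j = k div int q"
    have kj: "k = c + int q * j"
      using k mult_div_mod_eq[of "int q" k] by (simp add: j_def)
    have j: "(k - c) div int q = j" using kj assms(1) by simp
    have "?b \<ge> j" unfolding j[symmetric] using k assms(1) by (intro zdiv_mono1) auto
    moreover have "?a < j"
    proof (rule ccontr)
      assume "\<not> ?a < j"
      then have "int q * j \<le> int q * ?a" using assms(1) by simp
      also have "\<dots> \<le> M - c"
        using mult_div_mod_eq[of "int q" "M - c"] pos_mod_sign[of "int q" "M - c"] assms(1)
        by linarith
      finally show False using k kj by auto
    qed
    ultimately show "k \<in> (\<lambda>j. c + int q * j) ` {?a<..?b}" using kj by auto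
  qed
  then have "card {k \<in> {M<..N}. k mod int q = c} \<le> card {?a<..?b}"
    by (meson card_image_le card_mono finite_greaterThanAtMost_int finite_imageI le_trans)
  also have "\<dots> = nat (?b - ?a)" by simp
  finally have "real (card {k \<in> {M<..N}. k mod int q = c}) \<le> real (nat (?b - ?a))" by simp
  \<comment> \<open>Monotonicity of the floor gives \<open>?a \<le> ?b\<close>, so
    \<open>nat\<close> does not truncate.\<close>
  also have "\<dots> = real_of_int (?b - ?a)"
    using zdiv_mono1[of "M - c" "N - c" "int q"] assms by simp
  also have "\<dots> \<le> real_of_int (N - M) / q + 1"
  proof -
    have "real_of_int ?b \<le> real_of_int (N - c) / q"
      using real_of_int_div4[of "N - c" "int q"] by simp
    moreover have "real_of_int (M - c) / q \<le> real_of_int ?a + 1"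
      using real_of_int_div3[of "M - c" "int q"] by simp
    ultimately show ?thesis by (simp add: diff_divide_distrib)
  qed
  finally show ?thesis .
qed

text \<open>Union bound over the classes. The total error \<open>card S\<close> does not depend on
  the interval, so it vanishes uniformly after division by the length.\<close>

lemma card_residue_classes_le:
  fixes q :: nat and M N :: int
  assumes "q > 0" "M \<le> N" "finite S"
  shows "real (card {k \<in> {M<..N}. k mod int q \<in> S}) \<le> card S * (real_of_int (N - M) / q + 1)"
proof -
  have "{k \<in> {M<..N}. k mod int q \<in> S} = (\<Union>c\<in>S. {k \<in> {M<..N}. k mod int q = c})" by auto
  then have "real (card {k \<in> {M<..N}. k mod int q \<in> S}) \<le>
      (\<Sum>c\<in>S. real (card {k \<in> {M<..N}. k mod int q = c}))"
    using card_UN_le[OF assms(3), of "\<lambda>c. {k \<in> {M<..N}. k mod int q = c}"]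
    by (simp flip: of_nat_sum)
  also have "\<dots> \<le> (\<Sum>c\<in>S. real_of_int (N - M) / q + 1)"
    using card_residue_class_le[OF assms(1,2)] by (intro sum_mono) auto
  finally show ?thesis by simp
qed

section \<open>Frequencies in intervals and the upper Banach density\<close>

text \<open>This is the quotient under the supremum in \<open>upper_banach_density\<close>. On the
  empty interval \<open>M = N\<close> it is 0 / 0 = 0, which keeps the bounds 0 and 1 valid
  there.\<close>

definition interval_freq :: "int set \<Rightarrow> int \<Rightarrow> int \<Rightarrow> real" where
  "interval_freq E M N = real (card (E \<inter> {M<..N})) / real_of_int (N - M)"

lemma interval_freq_nonneg: "M \<le> N \<Longrightarrow> 0 \<le> interval_freq E M N"
  by (simp add: interval_freq_def)

lemma interval_freq_le_1:
  assumes "M \<le> N" shows "interval_freq E M N \<le> 1"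
proof -
  have "card (E \<inter> {M<..N}) \<le> card {M<..N}" by (intro card_mono) auto
  then have "real (card (E \<inter> {M<..N})) \<le> real_of_int (N - M)" using assms by simp
  then show ?thesis using assms by (simp add: interval_freq_def divide_le_eq)
qed

lemma interval_freq_mono:
  assumes "M \<le> N" "E \<subseteq> E'" shows "interval_freq E M N \<le> interval_freq E' M N"
  unfolding interval_freq_def using assms
  by (intro divide_right_mono of_nat_mono card_mono) auto

text \<open>The inequality is strict because at \<open>M = N\<close> both frequencies are 0 and do
  not add up to 1.\<close>

lemma interval_freq_Compl:
  assumes "M < N" shows "interval_freq (- E) M N = 1 - interval_freq E M N"
proof -
  have "card {M<..N} = card (E \<inter> {M<..N}) + card (- E \<inter> {M<..N})"
    by (subst card_Un_disjoint[symmetric])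
      (auto intro!: arg_cong[where f = card] simp del: card_greaterThanAtMost_int)
  then have "real_of_int (N - M) = card (E \<inter> {M<..N}) + card (- E \<inter> {M<..N})"
    using assms by simp
  moreover have "real_of_int (N - M) > 0" using assms by simp
  ultimately show ?thesis
    unfolding interval_freq_def by (simp add: field_simps)
qed

text \<open>These rules replace the limit of suprema by uniform estimates on all sufficiently long
  intervals. Both rest on the suprema \<open>s L\<close> decreasing to the density.\<close>

lemma upper_banach_density_bounds:
  shows upper_banach_density_leI:
      "(\<And>e. e > 0 \<Longrightarrow> \<exists>L. \<forall>M N. int L \<le> N - M \<longrightarrow> interval_freq E M N \<le> a + e) \<Longrightarrow>
        upper_banach_density E \<le> a"
    and upper_banach_density_geI:
      "(\<And>e. e > 0 \<Longrightarrow> \<exists>L. \<forall>M N. int L \<le> N - M \<longrightarrow> a - e \<le> interval_freq E M N) \<Longrightarrow>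
        a \<le> upper_banach_density E"
proof -
  define I where "I L = {(M, N). int L \<le> N - M}" for L
  define s where "s L = (SUP (M, N) \<in> I L. interval_freq E M N)" for L
  have ne: "(0, int L) \<in> I L" for L by (simp add: I_def)
  have bdd: "bdd_above ((\<lambda>(M, N). interval_freq E M N) ` I L)" for L
    by (rule bdd_aboveI[of _ 1]) (auto simp: I_def intro: interval_freq_le_1)
  \<comment> \<open>Decreasing and bounded below by 0, \<open>s\<close> converges; only then does
    \<open>lim\<close> in the density denote an actual limit.\<close>
  have "decseq s"
    unfolding s_def decseq_def
    by (intro allI impI cSUP_subset_mono bdd) (use ne in blast, auto simp: I_def)
  moreover have ge: "interval_freq E M N \<le> s L" if "(M, N) \<in> I L" for M N L
    unfolding s_def using cSUP_upper[OF that bdd] by simp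
  have "0 \<le> s L" for L
    using ge[OF ne] interval_freq_nonneg[of 0 "int L" E] by (metis of_nat_0_le_iff order_trans)
  ultimately obtain l where l: "s \<longlonglongrightarrow> l" using decseq_convergent by blast
  have d: "upper_banach_density E = l"
    using limI[OF l] unfolding upper_banach_density_def s_def I_def interval_freq_def .
  show "upper_banach_density E \<le> a"
    if *: "\<And>e. e > 0 \<Longrightarrow> \<exists>L. \<forall>M N. int L \<le> N - M \<longrightarrow> interval_freq E M N \<le> a + e"
  proof (rule field_le_epsilon)
    fix e :: real assume "e > 0"
    then obtain L where "\<forall>M N. int L \<le> N - M \<longrightarrow> interval_freq E M N \<le> a + e" using * by blast
    then have "s L \<le> a + e"
      unfolding s_def by (intro cSUP_least) (use ne in blast, auto simp: I_def)
    then show "upper_banach_density E \<le> a + e"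
      using decseq_ge[OF \<open>decseq s\<close> l, of L] d by simp
  qed
  show "a \<le> upper_banach_density E"
    if *: "\<And>e. e > 0 \<Longrightarrow> \<exists>L. \<forall>M N. int L \<le> N - M \<longrightarrow> a - e \<le> interval_freq E M N"
  proof (rule field_le_epsilon)
    fix e :: real assume "e > 0"
    then obtain L where L: "\<forall>M N. int L \<le> N - M \<longrightarrow> a - e \<le> interval_freq E M N" using * by blast
    \<comment> \<open>A single interval per length suffices here: (0, n] already has frequency at
      least \<open>a - e\<close>.\<close>
    have "a - e \<le> s n" if "n \<ge> L" for n
      using L ge[OF ne, of n] that by (smt (verit) of_nat_mono)
    then have "a - e \<le> l" by (intro LIMSEQ_le_const[OF l]) blast
    then show "a \<le> upper_banach_density E + e" using d by simp
  qed
qed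

section \<open>Haar measure of closed sets\<close>

lemma sets_padic_haar:
  assumes "prime p"
  shows "sets (padic_haar p) =
    sigma_sets (carrier (padic_int p)) {U. openin (padic_topology p) U}"
  using is_padic_haar_padic_haar[OF assms] by (simp add: is_padic_haar_def)

lemma padic_open_in_sets: "prime p \<Longrightarrow> openin (padic_topology p) U \<Longrightarrow> U \<in> sets (padic_haar p)"
  by (auto simp: sets_padic_haar)

lemma padic_closed_in_sets:
  assumes "prime p" "closedin (padic_topology p) F"
  shows "F \<in> sets (padic_haar p)"
proof -
  have sp: "space (padic_haar p) = topspace (padic_topology p)"
    using is_padic_haar_padic_haar[OF assms(1)] topspace_padic_topology[OF assms(1)]
    by (simp add: is_padic_haar_def)
  have "F = space (padic_haar p) - (topspace (padic_topology p) - F)"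
    using closedin_subset[OF assms(2)] by (auto simp: sp)
  moreover have "topspace (padic_topology p) - F \<in> sets (padic_haar p)"
    using assms by (intro padic_open_in_sets) auto
  ultimately show ?thesis by (metis sets.compl_sets)
qed

lemma measure_padic_residues:
  assumes "prime p" "S \<subseteq> {0..<int p ^ n}"
  shows "measure (padic_haar p) {x \<in> carrier (padic_int p). x n \<in> S} = card S / real p ^ n"
proof -
  interpret prob_space "padic_haar p"
    using is_padic_haar_padic_haar[OF assms(1)] by (simp add: is_padic_haar_def)
  have fin: "finite S" using assms(2) finite_subset by blast
  have "{x \<in> carrier (padic_int p). x n \<in> S} = (\<Union>c\<in>S. padic_cyl p n c)"
    by (auto simp: padic_cyl_def[OF assms(1)])
  also have "measure (padic_haar p) \<dots> = (\<Sum>c\<in>S. measure (padic_haar p) (padic_cyl p n c))"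
    by (rule finite_measure_finite_Union[OF fin])
      (use padic_open_in_sets openin_padic_cyl assms(1) in
        \<open>auto simp: disjoint_family_on_def padic_cyl_def\<close>)
  also have "\<dots> = (\<Sum>c\<in>S. 1 / real p ^ n)"
    using padic_haar_cyl[OF assms(1) is_padic_haar_padic_haar[OF assms(1)]] assms(2)
    by (intro sum.cong refl) (auto simp: measure_def)
  finally show ?thesis by simp
qed

lemma padic_closed_measure_tendsto:
  assumes p: "prime p" and F: "closedin (padic_topology p) F"
  shows "(\<lambda>n. card ((\<lambda>x. x n) ` F) / real p ^ n) \<longlonglongrightarrow> measure (padic_haar p) F"
proof -
  interpret prob_space "padic_haar p"
    using is_padic_haar_padic_haar[OF p] by (simp add: is_padic_haar_def)
  define C where "C n = {x \<in> carrier (padic_int p). x n \<in> (\<lambda>x. x n) ` F}" for n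
  have Fc: "F \<subseteq> carrier (padic_int p)"
    using closedin_subset[OF F] by (simp add: topspace_padic_topology[OF p])
  have "(\<Inter>n. C n) = F"
  proof (intro equalityI subsetI)
    fix x assume x: "x \<in> (\<Inter>n. C n)"
    then have xc: "x \<in> carrier (padic_int p)" by (auto simp: C_def)
    \<comment> \<open>Closedness enters here: a point outside \<open>F\<close> has a whole cylinder
      outside \<open>F\<close>, so it is missing from some \<open>C n\<close>.\<close>
    show "x \<in> F"
    proof (rule ccontr)
      assume "x \<notin> F"
      then have "x \<in> topspace (padic_topology p) - F"
        using xc by (simp add: topspace_padic_topology[OF p])
      moreover have "openin (padic_topology p) (topspace (padic_topology p) - F)" using F by auto
      ultimately obtain n where n: "padic_cyl p n (x n) \<subseteq> topspace (padic_topology p) - F"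
        using padic_open_cyl[OF p] by metis
      have "x n \<in> (\<lambda>x. x n) ` F" using x by (simp add: C_def)
      then obtain y where "y \<in> F" "y n = x n" by (metis imageE)
      then show False using n Fc by (auto simp: padic_cyl_def[OF p])
    qed
  qed (use Fc in \<open>auto simp: C_def\<close>)
  moreover have "decseq C"
  proof (rule decseq_SucI, rule subsetI)
    fix n x assume "x \<in> C (Suc n)"
    then obtain y where y: "y \<in> F" "x (Suc n) = y (Suc n)" and x: "x \<in> carrier (padic_int p)"
      by (auto simp: C_def)
    \<comment> \<open>By coherence, agreement modulo p^(n+1) implies agreement modulo p^n.\<close>
    then have "x n = y n" using Fc by (metis padic_carrier_iff[OF p] subsetD)
    then show "x \<in> C n" using x y by (auto simp: C_def)
  qed
  moreover have "C n = (\<Union>c\<in>(\<lambda>x. x n) ` F. padic_cyl p n c)" for n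
    by (auto simp: C_def padic_cyl_def[OF p])
  then have "range C \<subseteq> sets (padic_haar p)"
    using openin_padic_cyl[OF p] by (auto intro!: padic_open_in_sets[OF p] openin_Union)
  moreover have "measure (padic_haar p) (C n) = card ((\<lambda>x. x n) ` F) / real p ^ n" for n
    unfolding C_def using Fc padic_mem_range[OF p] by (intro measure_padic_residues[OF p]) blast
  ultimately show ?thesis
    using finite_Lim_measure_decseq[of C] by simp
qed

section \<open>Frequencies of closed sets and the comparison with the measure\<close>

text \<open>Half of \<open>e\<close> pays for replacing \<open>F\<close> by its neighbourhood modulo
  p^n, the other half for the counting error on a long interval. Since \<open>n\<close> and
  \<open>L\<close> are chosen before \<open>M\<close> and \<open>N\<close>, the bound is
  uniform.\<close>

lemma padic_closed_interval_freq_le: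
  assumes p: "prime p" and F: "closedin (padic_topology p) F" and e: "e > 0"
  shows "\<exists>L. \<forall>M N. int L \<le> N - M \<longrightarrow>
    interval_freq {k. padic_of_int p k \<in> F} M N \<le> measure (padic_haar p) F + e"
proof -
  have "eventually (\<lambda>n. card ((\<lambda>x. x n) ` F) / real p ^ n < measure (padic_haar p) F + e / 2)
      sequentially"
    using e by (intro order_tendstoD(2)[OF padic_closed_measure_tendsto[OF p F]]) simp
  then obtain n where n: "card ((\<lambda>x. x n) ` F) / real p ^ n < measure (padic_haar p) F + e / 2"
    by (auto simp: eventually_sequentially)
  define S where "S = (\<lambda>x. x n) ` F"
  have "S \<subseteq> {0..<int p ^ n}"
    using closedin_subset[OF F] padic_mem_range[OF p]
    unfolding S_def topspace_padic_topology[OF p] by blast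
  then have fin: "finite S" using finite_subset by blast
  \<comment> \<open>This \<open>L\<close> makes \<open>card S / real_of_int (N - M)\<close> at most
    \<open>e / 2\<close>; it is also positive, so the intervals considered are nonempty.\<close>
  obtain L :: nat where L: "2 * card S / e < L" using reals_Archimedean2 by blast
  have "interval_freq {k. padic_of_int p k \<in> F} M N \<le> measure (padic_haar p) F + e"
    if MN: "int L \<le> N - M" for M N
  proof -
    have "0 \<le> 2 * card S / e" using e by simp
    then have "0 < real L" using L by linarith
    then have pos: "real_of_int (N - M) > 0" "M \<le> N" using MN by auto
    have "real L \<le> real_of_int (N - M)" using MN by linarith
    then have "2 * card S / e < real_of_int (N - M)" using L by linarith
    then have small: "card S / real_of_int (N - M) \<le> e / 2"
      using e pos by (simp add: field_simps)
    have "{k. padic_of_int p k \<in> F} \<inter> {M<..N} \<subseteq> {k \<in> {M<..N}. k mod int (p ^ n) \<in> S}"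
      by (force simp: S_def padic_of_int_def)
    then have "real (card ({k. padic_of_int p k \<in> F} \<inter> {M<..N})) \<le>
        real (card {k \<in> {M<..N}. k mod int (p ^ n) \<in> S})"
      by (intro of_nat_mono card_mono) (auto intro: finite_subset[of _ "{M<..N}"])
    also have "\<dots> \<le> card S * (real_of_int (N - M) / (p ^ n) + 1)"
      using card_residue_classes_le[OF _ pos(2) fin, of "p ^ n"] prime_gt_0_nat[OF p] by simp
    finally have "interval_freq {k. padic_of_int p k \<in> F} M N \<le>
        card S * (real_of_int (N - M) / (p ^ n) + 1) / real_of_int (N - M)"
      unfolding interval_freq_def using pos by (intro divide_right_mono) auto
    also have "\<dots> = card S / real p ^ n + card S / real_of_int (N - M)"
      using pos prime_gt_0_nat[OF p] by (simp add: field_simps)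
    finally show ?thesis using n small unfolding S_def by linarith
  qed
  then show ?thesis by blast
qed

theorem mainTheorem1:
  fixes p :: nat and F :: "(nat \<Rightarrow> int) set"
  assumes "prime p"
    and "closedin (padic_topology p) F"
  shows "upper_banach_density {k. padic_of_int p k \<in> F} \<le> measure (padic_haar p) F \<and>
    (measure (padic_haar p) (padic_topology p frontier_of F) = 0 \<longrightarrow>
      upper_banach_density {k. padic_of_int p k \<in> F} = measure (padic_haar p) F)"
proof (intro conjI impI)
  let ?E = "{k. padic_of_int p k \<in> F}" and ?\<mu> = "padic_haar p" and ?T = "padic_topology p"
  show le: "upper_banach_density ?E \<le> measure ?\<mu> F"
    by (rule upper_banach_density_leI) (rule padic_closed_interval_freq_le[OF assms])
  assume null: "measure ?\<mu> (?T frontier_of F) = 0"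
  interpret prob_space ?\<mu>
    using is_padic_haar_padic_haar[OF assms(1)] by (simp add: is_padic_haar_def)
  have sp: "space ?\<mu> = topspace ?T" "topspace ?T = carrier (padic_int p)"
    using is_padic_haar_padic_haar[OF assms(1)] topspace_padic_topology[OF assms(1)]
    by (simp_all add: is_padic_haar_def)
  define U where "U = ?T interior_of F"
  define G where "G = topspace ?T - U"
  have G: "closedin ?T G" by (simp add: G_def U_def closedin_diff)
  have U_in: "U \<in> sets ?\<mu>" using assms(1) by (simp add: U_def padic_open_in_sets)
  have fr_in: "?T frontier_of F \<in> sets ?\<mu>"
    using assms(1) by (simp add: padic_closed_in_sets closedin_frontier_of)
  \<comment> \<open>A closed set is its interior together with its boundary, so a null boundary
    leaves all of the measure of \<open>F\<close> on \<open>U\<close>.\<close>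
  have "F \<subseteq> U \<union> ?T frontier_of F"
    using closure_of_closedin[OF assms(2)] by (auto simp: U_def frontier_of_def)
  then have "measure ?\<mu> F \<le> measure ?\<mu> (U \<union> ?T frontier_of F)"
    using U_in fr_in by (intro finite_measure_mono) auto
  also have "\<dots> \<le> measure ?\<mu> U"
    using measure_Un_le[OF U_in fr_in] null by simp
  finally have FU: "measure ?\<mu> F \<le> measure ?\<mu> U" .
  have GU: "measure ?\<mu> G = 1 - measure ?\<mu> U"
    using prob_compl[OF U_in] by (simp add: G_def sp)
  have "measure ?\<mu> F \<le> upper_banach_density ?E"
  proof (rule upper_banach_density_geI)
    fix e :: real assume "e > 0"
    from padic_closed_interval_freq_le[OF assms(1) G this] obtain L where
      L: "\<And>M N. int L \<le> N - M \<Longrightarrow>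
        interval_freq {k. padic_of_int p k \<in> G} M N \<le> measure ?\<mu> G + e" by blast
    \<comment> \<open>Since \<open>U\<close> lies in \<open>F\<close>, every integer outside
      \<open>F\<close> lies in \<open>G\<close>; an upper bound for the frequency of
      \<open>G\<close> is thus a lower bound for that of \<open>F\<close>.\<close>
    have sub: "- ?E \<subseteq> {k. padic_of_int p k \<in> G}"
      using padic_of_int_mem[OF assms(1)] interior_of_subset[of ?T F] by (auto simp: G_def U_def sp)
    \<comment> \<open>\<open>Suc L\<close> instead of \<open>L\<close> forces \<open>M < N\<close>,
      as the complement rule requires.\<close>
    have "measure ?\<mu> F - e \<le> interval_freq ?E M N" if "int (Suc L) \<le> N - M" for M N
    proof -
      have "1 - interval_freq ?E M N \<le> interval_freq {k. padic_of_int p k \<in> G} M N"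
        using interval_freq_mono[OF _ sub, of M N] interval_freq_Compl[of M N ?E] that by simp
      also have "\<dots> \<le> measure ?\<mu> G + e" using that by (intro L) simp
      finally show ?thesis using FU GU by linarith
    qed
    then show "\<exists>L. \<forall>M N. int L \<le> N - M \<longrightarrow> measure ?\<mu> F - e \<le> interval_freq ?E M N" by blast
  qed
  with le show "upper_banach_density ?E = measure ?\<mu> F" by simp
qed

end
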